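(* Consider a process under measurements and feedback control as described in the context, with system paths $X$, measurement outcomes $Y$, conditional path measures $\mathcal{M}_{|Y}$, reference path measures $\mathcal{M}^{\rm r}_{|\Lambda[Y]}$, entropy production $\sigma$, mutual information $I$ and initial correlation $I_{\rm i}$. Let $\mathcal{F}[X,Y]$ be a measurable real-valued functional for which the averages below are defined. Then for almost every $Y$ $$\langle\mathcal{F}e^{-\sigma-I-I_{\rm i}}\rangle_{|Y}=\langle\mathcal{F}\rangle^{\rm r}_{|\Lambda[Y]}-\langle\mathcal{F}\rangle^{\rm r}_{{\rm S}|\Lambda[Y]},\qquad \langle e^{-\sigma-I-I_{\rm i}}\rangle_{|Y}=1-\lambda_{{\rm S}|\Lambda[Y]},$$ and, averaging over $Y$, $$\langle\mathcal{F}e^{-\sigma-I-I_{\rm i}}\rangle=\langle\mathcal{F}\rangle^{\rm r}-\langle\mathcal{F}\rangle^{\rm r}_{\rm S},\qquad \langle e^{-\sigma-I-I_{\rm i}}\rangle=1-\overline{\lambda}_{\rm S}.$$ Consequently, if $I+I_{\rm i}$ is integrable, $$\langle\sigma\rangle\ge-\langle I+I_{\rm i}\rangle-\ln(1-\overline{\lambda}_{\rm S}).$$ In particular, if there is no initial correlation ($I_{\rm i}=0$), then $\langle\mathcal{F}e^{-\sigma-I}\rangle=\langle\mathcal{F}\rangle^{\rm r}-\langle\mathcal{F}\rangle^{\rm r}_{\rm S}$, $\langle e^{-\sigma-I}\rangle=1-\overline{\lambda}_{\rm S}$ and $\langle\sigma\rangle\ge-\langle I\rangle-\ln(1-\overline{\lambda}_{\rm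 S})$. If moreover every $\mathcal{M}_{|Y}$ is continuous (has no atoms), then $\langle\mathcal{F}e^{-\sigma-I}\rangle=\langle\mathcal{F}\rangle^{\rm r}-\langle\mathcal{F}\rangle^{\rm r}_{\rm sc}-\langle\mathcal{F}\rangle^{\rm r}_{\rm d}$, $\langle e^{-\sigma-I}\rangle=1-\overline{\lambda}_{\rm sc}-\overline{\lambda}_{\rm d}$ and $\langle\sigma\rangle\ge-\langle I\rangle-\ln(1-\overline{\lambda}_{\rm sc}-\overline{\lambda}_{\rm d})$.
   Context: $X$ ranges over a measurable space of system paths (singletons measurable) and $Y$ over a measurable space of measurement records, $Y$ having a probability law $P$. The control protocol $\Lambda[Y]$ is a function of $Y$. For each $Y$ there are three probability measures on system paths, depending measurably on $Y$: $\mathcal{M}_{|Y}$, the conditional law of $X$ given the outcomes $Y$; $\mathcal{M}^{\rm tr}_{|\Lambda[Y]}$, the law of $X$ (transition probability) under the fixed protocol $\Lambda[Y]$; and $\mathcal{M}^{\rm r}_{|\Lambda[Y]}$, the reference path measure under the protocol $\Lambda[Y]$. For each $Y$, $\mathcal{M}^{\rm r}_{|\Lambda[Y]}=\mathcal{M}^{\rm r}_{{\rm AC}|\Lambda[Y]}+\mathcal{M}^{\rm r}_{{\rm S}|\Lambda[Y]}$ is the Lebesgue decomposition with respect to $\mathcal{M}_{|Y}$ (absolutely continuous and singular parts), and $\lambda_{{\rm S}|\Lambda[Y]}$ is the total mass of $\mathcal{M}^{\rm r}_{{\rm S}|\Lambda[Y]}$. If $\mathcal{M}_{|Y}$ is continuous,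 the singular part splits further uniquely into a continuous part $\mathcal{M}^{\rm r}_{{\rm sc}|\Lambda[Y]}$ and a discrete (purely atomic on points) part $\mathcal{M}^{\rm r}_{{\rm d}|\Lambda[Y]}$, of total masses $\lambda_{{\rm sc}|\Lambda[Y]}$, $\lambda_{{\rm d}|\Lambda[Y]}$. All these parts, and the densities below, are taken to depend measurably on $Y$ (jointly on $(X,Y)$ for densities). Standing assumption: $\mathcal{M}^{\rm r}_{{\rm AC}|\Lambda[Y]}\ll\mathcal{M}^{\rm tr}_{|\Lambda[Y]}\ll\mathcal{M}_{|Y}$. The entropy production $\sigma$ and the information $I+I_{\rm i}$ ($I$ is the total mutual information obtained by the measurements, $I_{\rm i}$ the initial correlation between system and outcomes) are given by $$e^{-\sigma}=\frac{d\mathcal{M}^{\rm r}_{{\rm AC}|\Lambda[Y]}}{d\mathcal{M}^{\rm tr}_{|\Lambda[Y]}}(X),\qquad e^{-I-I_{\rm i}}=\frac{d\mathcal{M}^{\rm tr}_{|\Lambda[Y]}}{d\mathcal{M}_{|Y}}(X).$$ Averages: $\langle\cdot\rangle_{|Y}$ is over $\mathcal{M}_{|Y}$, and $\langle\cdot\rangle=\int P(dY)\langle\cdot\rangle_{|Y}$; $\langle\cdot\rangle^{\rm r}_{|\Lambda[Y]}$ and $\langle\cdot\rangle^{\rm r}_{{\rm J}|\Lambda[Y]}$ (${\rm J}={\rm S},{\rm sc},{\rm d}$) are integrals against $\mathcal{M}^{\rm r}_{|\Lambda[Y]}$ and $\mathcal{M}^{\rm r}_{{\rm J}|\Lambda[Y]}$,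 and $\langle\cdot\rangle^{\rm r}$, $\langle\cdot\rangle^{\rm r}_{\rm J}$ are their integrals over $P(dY)$; $\overline{\lambda}_{\rm J}=\int P(dY)\lambda_{{\rm J}|\Lambda[Y]}$. Conventions: $-\ln0=+\infty$, $e^{-\infty}=0$; averages of $\sigma$ may be $+\infty$. *)

theory Defs
  imports "HOL-Probability.Probability"
begin

section \<open>Decompositions of path measures\<close>

definition mutually_singular :: "'a measure \<Rightarrow> 'a measure \<Rightarrow> bool" where
  "mutually_singular M N \<longleftrightarrow>
     (\<exists>A\<in>sets M. emeasure M A = 0 \<and> emeasure N (space N - A) = 0)"

definition measure_split :: "'a measure \<Rightarrow> 'a measure \<Rightarrow> 'a measure \<Rightarrow> bool" where
  "measure_split N N1 N2 \<longleftrightarrow> sets N1 = sets N \<and> sets N2 = sets N \<and>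
     (\<forall>A\<in>sets N. emeasure N A = emeasure N1 A + emeasure N2 A)"

definition lebesgue_decomposition ::
    "'a measure \<Rightarrow> 'a measure \<Rightarrow> 'a measure \<Rightarrow> 'a measure \<Rightarrow> bool" where
  "lebesgue_decomposition M N Nac Ns \<longleftrightarrow>
     measure_split N Nac Ns \<and> absolutely_continuous M Nac \<and> mutually_singular M Ns"

text \<open>Atoms are atoms at points; all singletons are measurable in the path space below.\<close>

definition continuous_measure :: "'a measure \<Rightarrow> bool" where
  "continuous_measure M \<longleftrightarrow> (\<forall>x\<in>space M. emeasure M {x} = 0)"

definition discrete_measure :: "'a measure \<Rightarrow> bool" where
  "discrete_measure M \<longleftrightarrow>
     (\<exists>C. countable C \<and> C \<subseteq> space M \<and> emeasure M (space M - C) = 0)"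

definition continuous_discrete_decomposition ::
    "'a measure \<Rightarrow> 'a measure \<Rightarrow> 'a measure \<Rightarrow> bool" where
  "continuous_discrete_decomposition N Nc Nd \<longleftrightarrow>
     measure_split N Nc Nd \<and> continuous_measure Nc \<and> discrete_measure Nd"


section \<open>Exponential and logarithm with the conventions at infinity\<close>

definition eexp :: "ereal \<Rightarrow> ennreal" where
  "eexp x = (case x of ereal r \<Rightarrow> ennreal (exp r) | PInfty \<Rightarrow> \<infinity> | MInfty \<Rightarrow> 0)"

text \<open>Only used for nonnegative arguments, where the convention is \<open>- ln 0 = \<infinity>\<close>.\<close>

definition eln :: "real \<Rightarrow> ereal" where
  "eln r = (if r \<le> 0 then - \<infinity> else ereal (ln r))"


section \<open>Averages\<close>

text \<open>\<open>e2ennreal\<close> truncates at 0, so the two integrals below are those of the positive and the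
  negative part. The value is meaningful only under \<open>ext_integral_defined\<close>,
  as \<open>\<infinity> - \<infinity> = \<infinity>\<close> in \<open>ereal\<close>.\<close>

definition ext_integral :: "'a measure \<Rightarrow> ('a \<Rightarrow> ereal) \<Rightarrow> ereal" where
  "ext_integral M f =
     enn2ereal (\<integral>\<^sup>+x. e2ennreal (f x) \<partial>M) - enn2ereal (\<integral>\<^sup>+x. e2ennreal (- f x) \<partial>M)"

definition ext_integral_defined :: "'a measure \<Rightarrow> ('a \<Rightarrow> ereal) \<Rightarrow> bool" where
  "ext_integral_defined M f \<longleftrightarrow> f \<in> borel_measurable M \<and>
     ((\<integral>\<^sup>+x. e2ennreal (f x) \<partial>M) < \<infinity> \<or> (\<integral>\<^sup>+x. e2ennreal (- f x) \<partial>M) < \<infinity>)"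

text \<open>In the averages below, \<open>P\<close> is the law of the measurement record and \<open>K y\<close> is a measure on
  system paths for each record \<open>y\<close>.\<close>

definition path_average :: "'y measure \<Rightarrow> ('y \<Rightarrow> 'x measure) \<Rightarrow> ('x \<Rightarrow> 'y \<Rightarrow> real) \<Rightarrow> real" where
  "path_average P K f = (\<integral>y. (\<integral>x. f x y \<partial>K y) \<partial>P)"

definition path_average_defined ::
    "'y measure \<Rightarrow> ('y \<Rightarrow> 'x measure) \<Rightarrow> ('x \<Rightarrow> 'y \<Rightarrow> real) \<Rightarrow> bool" where
  "path_average_defined P K f \<longleftrightarrow>
     (AE y in P. integrable (K y) (\<lambda>x. f x y)) \<and> integrable P (\<lambda>y. \<integral>x. f x y \<partial>K y)"

definition ext_average ::
    "'y measure \<Rightarrow> ('y \<Rightarrow> 'x measure) \<Rightarrow> ('x \<Rightarrow> 'y \<Rightarrow> ereal) \<Rightarrow> ereal" where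
  "ext_average P K f = ext_integral P (\<lambda>y. ext_integral (K y) (\<lambda>x. f x y))"

definition ext_average_defined ::
    "'y measure \<Rightarrow> ('y \<Rightarrow> 'x measure) \<Rightarrow> ('x \<Rightarrow> 'y \<Rightarrow> ereal) \<Rightarrow> bool" where
  "ext_average_defined P K f \<longleftrightarrow>
     (AE y in P. ext_integral_defined (K y) (\<lambda>x. f x y)) \<and>
     ext_integral_defined P (\<lambda>y. ext_integral (K y) (\<lambda>x. f x y))"

definition path_integrable ::
    "'y measure \<Rightarrow> ('y \<Rightarrow> 'x measure) \<Rightarrow> ('x \<Rightarrow> 'y \<Rightarrow> ereal) \<Rightarrow> bool" where
  "path_integrable P K f \<longleftrightarrow> (\<integral>\<^sup>+y. (\<integral>\<^sup>+x. e2ennreal \<bar>f x y\<bar> \<partial>K y) \<partial>P) < \<infinity>"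

definition total_mass :: "'x measure \<Rightarrow> real" where
  "total_mass N = measure N (space N)"

definition mean_mass :: "'y measure \<Rightarrow> ('y \<Rightarrow> 'x measure) \<Rightarrow> real" where
  "mean_mass P K = (\<integral>y. total_mass (K y) \<partial>P)"


section \<open>Processes under measurement and feedback control\<close>

text \<open>\<open>S\<close> only serves as the measurable space of system paths. The transition and reference measures
  \<open>Mtr\<close>, \<open>Mr\<close> are functions of the protocol \<open>Lam y\<close>, while the Lebesgue parts \<open>MrAC\<close>, \<open>MrS\<close> also
  depend on \<open>y\<close> through \<open>M y\<close>. As densities are finite, \<open>\<sigma>\<close>, \<open>I\<close> and \<open>Ii\<close> may be \<open>\<infinity>\<close>,
  but not \<open>- \<infinity>\<close>.\<close>

locale feedback_process = prob_space P
  for P :: "'y measure" +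
  fixes S :: "'x measure"
    and Lam :: "'y \<Rightarrow> 'l"
    and M :: "'y \<Rightarrow> 'x measure"
    and Mtr Mr :: "'l \<Rightarrow> 'x measure"
    and MrAC MrS :: "'y \<Rightarrow> 'x measure"
    and \<sigma> I Ii :: "'x \<Rightarrow> 'y \<Rightarrow> ereal"
  assumes singleton_sets: "\<And>x. x \<in> space S \<Longrightarrow> {x} \<in> sets S"
    and M_kernel: "M \<in> P \<rightarrow>\<^sub>M prob_algebra S"
    and Mtr_kernel: "(\<lambda>y. Mtr (Lam y)) \<in> P \<rightarrow>\<^sub>M prob_algebra S"
    and Mr_kernel: "(\<lambda>y. Mr (Lam y)) \<in> P \<rightarrow>\<^sub>M prob_algebra S"
    and MrAC_kernel: "MrAC \<in> P \<rightarrow>\<^sub>M subprob_algebra S"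
    and MrS_kernel: "MrS \<in> P \<rightarrow>\<^sub>M subprob_algebra S"
    and decomposition:
      "\<And>y. y \<in> space P \<Longrightarrow> lebesgue_decomposition (M y) (Mr (Lam y)) (MrAC y) (MrS y)"
    and ac_MrAC: "\<And>y. y \<in> space P \<Longrightarrow> absolutely_continuous (Mtr (Lam y)) (MrAC y)"
    and ac_Mtr: "\<And>y. y \<in> space P \<Longrightarrow> absolutely_continuous (M y) (Mtr (Lam y))"
    and \<sigma>_measurable: "(\<lambda>(x, y). \<sigma> x y) \<in> borel_measurable (S \<Otimes>\<^sub>M P)"
    and I_measurable: "(\<lambda>(x, y). I x y) \<in> borel_measurable (S \<Otimes>\<^sub>M P)"
    and Ii_measurable: "(\<lambda>(x, y). Ii x y) \<in> borel_measurable (S \<Otimes>\<^sub>M P)"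
    and not_MInfty: "\<And>x y. x \<in> space S \<Longrightarrow> y \<in> space P \<Longrightarrow>
      \<sigma> x y \<noteq> - \<infinity> \<and> I x y \<noteq> - \<infinity> \<and> Ii x y \<noteq> - \<infinity>"
    and entropy_production: "\<And>y. y \<in> space P \<Longrightarrow>
      AE x in Mtr (Lam y). eexp (- \<sigma> x y) = RN_deriv (Mtr (Lam y)) (MrAC y) x"
    and information: "\<And>y. y \<in> space P \<Longrightarrow>
      AE x in M y. eexp (- I x y - Ii x y) = RN_deriv (M y) (Mtr (Lam y)) x"

end

theory Submission
  imports Defs
begin

text \<open>
  By the chain rule for Radon-Nikodym derivatives, \<open>exp (- \<sigma> - I - Ii)\<close> is the density of the
  absolutely continuous part of the reference measure with respect to the conditional measure.
  Hence integrating against it gives the reference average minus the singular one.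

  The inequality is Jensen's, in its tangent form \<open>\<sigma> + J \<ge> 1 - ln c - exp (- \<sigma> - J) / c\<close>, integrated
  against the joint law of paths and records and taken at \<open>c = 1 - \<lambda>\<close>, with \<open>J = I + Ii\<close> and \<open>\<lambda>\<close> the mean singular
  mass. If \<open>\<lambda> = 1\<close>, the exponential vanishes almost everywhere and letting \<open>c\<close> tend to \<open>0\<close> shows
  \<open>\<langle>\<sigma>\<rangle> = \<infinity>\<close>.
\<close>

subsection \<open>Splitting a measure\<close>

text \<open>The split is an identity on measurable sets, that is, for indicators; induction over
  linear combinations and monotone limits carries it to nonnegative functions. No finiteness is
  involved, since all sums live in \<open>ennreal\<close>.\<close>

lemma nn_integral_measure_split:
  assumes "measure_split N N1 N2" "f \<in> borel_measurable N"
  shows "(\<integral>\<^sup>+x. f x \<partial>N) = (\<integral>\<^sup>+x. f x \<partial>N1) + (\<integral>\<^sup>+x. f x \<partial>N2)"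
proof -
  have S: "sets N1 = sets N" "sets N2 = sets N"
    and E: "\<And>A. A \<in> sets N \<Longrightarrow> emeasure N A = emeasure N1 A + emeasure N2 A"
    using assms(1) by (auto simp: measure_split_def)
  have M: "g \<in> borel_measurable N \<Longrightarrow> g \<in> borel_measurable N1 \<and> g \<in> borel_measurable N2"
    for g :: "'a \<Rightarrow> ennreal"
    using S by (simp cong: measurable_cong_sets)
  have sp: "space N1 = space N" "space N2 = space N"
    using S by (auto dest: sets_eq_imp_space_eq)
  show ?thesis
    using assms(2)
  proof (induction rule: borel_measurable_induct)
    case (cong f g)
    then show ?case using sp by (auto cong: nn_integral_cong_simp)
  next
    case (set A)
    then show ?case using S E by simp
  next
    case (mult u c)
    then show ?case using M[OF mult(2)] by (simp add: nn_integral_cmult distrib_left)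
  next
    case (add u v)
    then show ?case using M[of u] M[of v] by (simp add: nn_integral_add add_ac)
  next
    case (seq U)
    have "(\<integral>\<^sup>+x. (SUP i. U i x) \<partial>N) = (SUP i. (\<integral>\<^sup>+x. U i x \<partial>N1) + (\<integral>\<^sup>+x. U i x \<partial>N2))"
      using seq by (simp add: nn_integral_monotone_convergence_SUP)
    also have "\<dots> = (SUP i. \<integral>\<^sup>+x. U i x \<partial>N1) + (SUP i. \<integral>\<^sup>+x. U i x \<partial>N2)"
      using seq(3) by (intro ennreal_SUP_add)
        (auto simp: incseq_def le_fun_def intro!: nn_integral_mono)
    finally show ?case
      using seq M by (simp add: nn_integral_monotone_convergence_SUP SUP_apply image_comp)
  qed
qed

text \<open>The integrals of the norm over the two parts add up in \<open>ennreal\<close>, and such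
  a sum is finite exactly when both terms are. The value then follows by splitting the integrals of
  the positive and of the negative part.\<close>

lemma
  fixes f :: "'a \<Rightarrow> real"
  assumes "measure_split N N1 N2"
  shows integrable_measure_split_iff:
      "integrable N f \<longleftrightarrow> integrable N1 f \<and> integrable N2 f"
    and integral_measure_split:
      "integrable N1 f \<Longrightarrow> integrable N2 f \<Longrightarrow>
        (\<integral>x. f x \<partial>N) = (\<integral>x. f x \<partial>N1) + (\<integral>x. f x \<partial>N2)"
proof -
  have M: "f \<in> borel_measurable N1 \<longleftrightarrow> f \<in> borel_measurable N"
      "f \<in> borel_measurable N2 \<longleftrightarrow> f \<in> borel_measurable N"
    using assms by (auto simp: measure_split_def cong: measurable_cong_sets)
  note split = nn_integral_measure_split[OF assms]
  show iff: "integrable N f \<longleftrightarrow> integrable N1 f \<and> integrable N2 f"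
    using M by (auto simp: integrable_iff_bounded split)
  assume int: "integrable N1 f" "integrable N2 f"
  then have "integrable N f" using iff by blast
  then have "(\<lambda>x. ennreal (f x)) \<in> borel_measurable N" "(\<lambda>x. ennreal (- f x)) \<in> borel_measurable N"
    by measurable
  note split = this[THEN split]
  from int \<open>integrable N f\<close> show "(\<integral>x. f x \<partial>N) = (\<integral>x. f x \<partial>N1) + (\<integral>x. f x \<partial>N2)"
    by (simp add: split real_lebesgue_integral_def enn2real_plus real_integrable_def less_top)
qed

lemma total_mass_nonneg: "0 \<le> total_mass N"
  by (simp add: total_mass_def)

lemma total_mass_measure_split:
  assumes "measure_split N N1 N2" "finite_measure N1" "finite_measure N2"
  shows "total_mass N = total_mass N1 + total_mass N2"
proof -
  have "space N1 = space N" "space N2 = space N"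
    using assms(1) by (auto simp: measure_split_def dest: sets_eq_imp_space_eq)
  with assms show ?thesis
    by (simp add: measure_split_def total_mass_def measure_def enn2real_plus
        finite_measure.emeasure_finite less_top[symmetric])
qed

subsection \<open>The extended exponential\<close>

lemma measurable_eexp [measurable]: "eexp \<in> borel_measurable borel"
proof -
  \<comment> \<open>Replacing the case distinction by conditions on measurable sets makes
    measurability automatic.\<close>
  have "eexp = (\<lambda>x. if x = \<infinity> then \<infinity> else if x = - \<infinity> then 0
      else ennreal (exp (real_of_ereal x)))"
    by (auto simp: eexp_def fun_eq_iff split: ereal.split)
  moreover have "\<dots> \<in> borel_measurable borel" by measurable
  ultimately show ?thesis by simp
qed

lemma eexp_ereal [simp]: "eexp (ereal r) = ennreal (exp r)"
  and eexp_PInfty [simp]: "eexp \<infinity> = \<infinity>"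
  and eexp_MInfty [simp]: "eexp (- \<infinity>) = 0"
  by (simp_all add: eexp_def)

lemma eexp_finite: "x \<noteq> \<infinity> \<Longrightarrow> eexp x < \<infinity>"
  by (cases x) auto

text \<open>With \<open>- \<infinity>\<close> excluded, neither exponent is
  \<open>\<infinity>\<close> and both factors are finite. Otherwise the law can fail: \<infinity> -
  \<infinity> = \<infinity> in \<open>ereal\<close>, whereas \<infinity> * 0 = 0 in
  \<open>ennreal\<close>.\<close>

lemma eexp_minus_diff:
  assumes "x \<noteq> - \<infinity>" "y \<noteq> - \<infinity>" "z \<noteq> - \<infinity>"
  shows "eexp (- x - y - z) = eexp (- x) * eexp (- y - z)"
  using assms
  by (cases x; cases y; cases z) (auto simp: ennreal_mult[symmetric] exp_add[symmetric])

lemma ereal_le_abs: "x \<le> \<bar>x\<bar>" and ereal_minus_le_abs: "- x \<le> \<bar>x\<bar>"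
  for x :: ereal
  by (cases x; simp)+

subsection \<open>A Jensen inequality\<close>

text \<open>The tangent of \<open>exp\<close> at \<open>ln c\<close>, with every term moved to the side where it is nonnegative.\<close>

lemma tangent_eexp:
  assumes "s \<noteq> - \<infinity>" "\<bar>j\<bar> \<noteq> \<infinity>" "0 < c" "c \<le> 1"
  shows "ennreal (1 - ln c) + e2ennreal (- s) + e2ennreal (- j)
    \<le> e2ennreal s + e2ennreal j + eexp (- s - j) * ennreal (1 / c)"
proof (cases s)
  case PInf
  then show ?thesis by simp
next
  case MInf
  with assms show ?thesis by simp
next
  case (real a)
  obtain b where b: "j = ereal b" using assms by (cases j) auto
  have "1 + (- a - b - ln c) \<le> exp (- a - b - ln c)" by (rule exp_ge_add_one_self)
  also have "\<dots> = exp (- a - b) / c" using assms by (simp add: exp_diff)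
  finally have "(1 - ln c) + max 0 (- a) + max 0 (- b) \<le> max 0 a + max 0 b + exp (- a - b) / c"
    by linarith
  \<comment> \<open>Here \<open>c \<le> 1\<close> enters: \<open>ennreal\<close> would truncate a
    negative \<open>1 - ln c\<close> to 0.\<close>
  moreover have "0 \<le> 1 - ln c" using ln_le_minus_one[of c] assms by simp
  ultimately have "ennreal (1 - ln c) + ennreal (max 0 (- a)) + ennreal (max 0 (- b))
      \<le> ennreal (max 0 a) + ennreal (max 0 b) + ennreal (exp (- a - b) / c)"
    using assms by (simp add: ennreal_plus[symmetric] ennreal_leI
        del: ennreal_plus ennreal_max_0 ennreal_max_0')
  then show ?thesis
    using assms by (simp add: real b ennreal_mult[symmetric])
qed

context prob_space
begin

text \<open>This rules out \<infinity> - \<infinity> in the average of \<open>s\<close>. Where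
  \<open>s\<close> is negative and \<open>j\<close> is finite, exp t \<ge> 1 + t at t = - s - j
  bounds - s by |j| + exp (- s - j), which has finite integral.\<close>

lemma nn_integral_neg_finite:
  fixes s j :: "'a \<Rightarrow> ereal"
  assumes [measurable]: "s \<in> borel_measurable M" "j \<in> borel_measurable M"
    and s: "AE x in M. s x \<noteq> - \<infinity>"
    and j: "(\<integral>\<^sup>+x. e2ennreal \<bar>j x\<bar> \<partial>M) < \<infinity>"
    and E: "(\<integral>\<^sup>+x. eexp (- s x - j x) \<partial>M) < \<infinity>"
  shows "(\<integral>\<^sup>+x. e2ennreal (- s x) \<partial>M) < \<infinity>"
proof -
  have "e2ennreal (- s) \<le> e2ennreal \<bar>j\<bar> + eexp (- s - j)" if "s \<noteq> - \<infinity>" for s j :: ereal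
  proof (cases "s \<ge> 0 \<or> \<bar>j\<bar> = \<infinity>")
    case True
    then show ?thesis by (auto simp: e2ennreal_neg)
  next
    case False
    with that obtain a b where ab: "s = ereal a" "j = ereal b" by (cases s; cases j) auto
    have "- a \<le> \<bar>b\<bar> + exp (- a - b)" using exp_ge_add_one_self[of "- a - b"] by linarith
    then have "ennreal (- a) \<le> ennreal \<bar>b\<bar> + ennreal (exp (- a - b))"
      by (simp add: ennreal_plus[symmetric] ennreal_leI del: ennreal_plus)
    then show ?thesis by (simp add: ab)
  qed
  then have "(\<integral>\<^sup>+x. e2ennreal (- s x) \<partial>M) \<le> (\<integral>\<^sup>+x. e2ennreal \<bar>j x\<bar> + eexp (- s x - j x) \<partial>M)"
    using s by (intro nn_integral_mono_AE) auto
  also have "\<dots> = (\<integral>\<^sup>+x. e2ennreal \<bar>j x\<bar> \<partial>M) + (\<integral>\<^sup>+x. eexp (- s x - j x) \<partial>M)"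
    by (intro nn_integral_add) auto
  also have "\<dots> < \<infinity>" using j E by simp
  finally show ?thesis .
qed

text \<open>If the positive part \<open>Sp\<close> diverges, the average of \<open>s\<close> is
  \<infinity>. Otherwise all four integrals are finite and the integrated tangent inequality can be
  rearranged among real numbers.\<close>

lemma ext_integral_ge_eln:
  fixes s j :: "'a \<Rightarrow> ereal"
  assumes [measurable]: "s \<in> borel_measurable M" "j \<in> borel_measurable M"
    and s: "AE x in M. s x \<noteq> - \<infinity>"
    and j: "(\<integral>\<^sup>+x. e2ennreal \<bar>j x\<bar> \<partial>M) < \<infinity>"
    and E: "(\<integral>\<^sup>+x. eexp (- s x - j x) \<partial>M) = ennreal e" "0 \<le> e" "e \<le> 1"
  shows "ext_integral M s \<ge> - ext_integral M j - eln e"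
proof -
  define Sp Sn Jp Jn where "Sp = (\<integral>\<^sup>+x. e2ennreal (s x) \<partial>M)"
    and "Sn = (\<integral>\<^sup>+x. e2ennreal (- s x) \<partial>M)"
    and "Jp = (\<integral>\<^sup>+x. e2ennreal (j x) \<partial>M)"
    and "Jn = (\<integral>\<^sup>+x. e2ennreal (- j x) \<partial>M)"
  have "AE x in M. e2ennreal \<bar>j x\<bar> \<noteq> \<infinity>"
    using j by (intro nn_integral_PInf_AE) auto
  then have fin: "AE x in M. \<bar>j x\<bar> \<noteq> \<infinity>" by eventually_elim auto
  have "Jp \<le> (\<integral>\<^sup>+x. e2ennreal \<bar>j x\<bar> \<partial>M)" "Jn \<le> (\<integral>\<^sup>+x. e2ennreal \<bar>j x\<bar> \<partial>M)"
    unfolding Jp_def Jn_def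
    by (auto intro!: nn_integral_mono e2ennreal_mono ereal_le_abs ereal_minus_le_abs)
  then obtain jp jn where jpn: "Jp = ennreal jp" "Jn = ennreal jn" "0 \<le> jp" "0 \<le> jn"
    using j by (cases Jp; cases Jn) (auto simp: top_unique)
  have "Sn < \<infinity>" unfolding Sn_def
    using s j E by (intro nn_integral_neg_finite) auto
  then obtain sn where sn: "Sn = ennreal sn" "0 \<le> sn" by (cases Sn) auto
  have key: "ennreal (1 - ln c) + Sn + Jn \<le> Sp + Jp + ennreal e * ennreal (1 / c)"
    if c: "0 < c" "c \<le> 1" for c
  proof -
    have "(\<integral>\<^sup>+x. ennreal (1 - ln c) + e2ennreal (- s x) + e2ennreal (- j x) \<partial>M)
      \<le> (\<integral>\<^sup>+x. e2ennreal (s x) + e2ennreal (j x) + eexp (- s x - j x) * ennreal (1 / c) \<partial>M)"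
      using s fin
      by (intro nn_integral_mono_AE, eventually_elim) (auto intro!: tangent_eexp c)
    then show ?thesis
      by (simp add: nn_integral_add nn_integral_multc E emeasure_space_1 Sp_def Sn_def Jp_def Jn_def)
  qed
  have J: "ext_integral M j = ereal (jp - jn)"
    using jpn by (simp add: ext_integral_def flip: Jp_def Jn_def)
  have S: "ext_integral M s = enn2ereal Sp - ereal sn"
    using sn by (simp add: ext_integral_def flip: Sp_def Sn_def)
  show ?thesis
  proof (cases Sp)
    case top
    then show ?thesis by (simp add: S)
  next
    case (real sp)
    have key': "1 - ln c + sn + jn \<le> sp + jp + e / c" if c: "0 < c" "c \<le> 1" for c
    proof -
      have "0 \<le> 1 - ln c" using ln_le_minus_one[of c] c by simp
      then show ?thesis
        using key[OF c] jpn sn real E c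
        by (simp add: ennreal_mult[symmetric] ennreal_plus[symmetric] del: ennreal_plus)
    qed
    \<comment> \<open>A finite \<open>Sp\<close> forces \<open>e\<close> to be positive, so that
      \<open>eln e\<close> is the ordinary logarithm: for \<open>e = 0\<close> the chosen
      \<open>c\<close> has - ln c = sp + jp, and the inequality becomes 1 + sn + jn \<le> 0.\<close>
    have "0 < e"
    proof (rule ccontr)
      assume "\<not> 0 < e"
      with E have "e = 0" by simp
      with key'[of "exp (- (sp + jp))"] sn jpn real show False by simp
    qed
    \<comment> \<open>At \<open>c = e\<close> the term e / c is 1 and cancels the constant of the
      tangent.\<close>
    with key'[of e] E real show ?thesis
      by (simp add: S J eln_def)
  qed
qed

end

subsection \<open>Averages over a kernel\<close>

lemma measurable_kernel_section:
  assumes "case_prod f \<in> S \<Otimes>\<^sub>M P \<rightarrow>\<^sub>M N" "K \<in> P \<rightarrow>\<^sub>M subprob_algebra S" "y \<in> space P"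
  shows "(\<lambda>x. f x y) \<in> K y \<rightarrow>\<^sub>M N"
  using measurable_compose[OF measurable_Pair2'[OF assms(3)] assms(1)]
  by (simp add: subprob_measurableD(3)[OF assms(2,3)])

lemma measurable_into_joint:
  assumes "K \<in> P \<rightarrow>\<^sub>M subprob_algebra S" "y \<in> space P"
  shows "(\<lambda>x. (x, y)) \<in> K y \<rightarrow>\<^sub>M S \<Otimes>\<^sub>M P"
  using measurable_Pair2'[OF assms(2)] by (simp add: subprob_measurableD(3)[OF assms])

text \<open>Pushing \<open>K y\<close> forward along \<open>\<lambda>x. (x, y)\<close> carries the
  record along with the path. An integrand depending on both then becomes one fixed function on the
  product space, and only the measure varies with \<open>y\<close>.\<close>

lemma measurable_joint_kernel:
  assumes "K \<in> P \<rightarrow>\<^sub>M subprob_algebra S"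
  shows "(\<lambda>y. distr (K y) (S \<Otimes>\<^sub>M P) (\<lambda>x. (x, y))) \<in> P \<rightarrow>\<^sub>M subprob_algebra (S \<Otimes>\<^sub>M P)"
  using measurable_pair_swap' assms by (intro measurable_distr2[where M = S]) auto

lemma measurable_kernel_nn_integral:
  assumes K: "K \<in> P \<rightarrow>\<^sub>M subprob_algebra S" and f: "case_prod f \<in> borel_measurable (S \<Otimes>\<^sub>M P)"
  shows "(\<lambda>y. \<integral>\<^sup>+x. f x y \<partial>K y) \<in> borel_measurable P"
  using measurable_pair_swap[OF f]
  by (intro nn_integral_measurable_subprob_algebra2[OF _ K]) (simp add: case_prod_beta)

lemma measurable_kernel_integral:
  fixes f :: "'x \<Rightarrow> 'y \<Rightarrow> real"
  assumes K: "K \<in> P \<rightarrow>\<^sub>M subprob_algebra S" and f: "case_prod f \<in> borel_measurable (S \<Otimes>\<^sub>M P)"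
  shows "(\<lambda>y. \<integral>x. f x y \<partial>K y) \<in> borel_measurable P"
proof -
  have "(\<lambda>y. \<integral>z. case_prod f z \<partial>distr (K y) (S \<Otimes>\<^sub>M P) (\<lambda>x. (x, y))) \<in> borel_measurable P"
    by (rule measurable_compose[OF measurable_joint_kernel[OF K] integral_measurable_subprob_algebra[OF f]])
  moreover have "(\<integral>z. case_prod f z \<partial>distr (K y) (S \<Otimes>\<^sub>M P) (\<lambda>x. (x, y))) = (\<integral>x. f x y \<partial>K y)"
    if "y \<in> space P" for y
    using measurable_into_joint[OF K that] f by (simp add: integral_distr)
  ultimately show ?thesis by (simp cong: measurable_cong)
qed

text \<open>This lifts identities between integrals at almost every record to averages. The inner
  integral is measurable in \<open>y\<close> because \<open>K\<close> is a kernel, so agreement with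
  \<open>h\<close> almost everywhere transfers both integrability and value.\<close>

lemma path_average_eqI:
  assumes "case_prod f \<in> borel_measurable (S \<Otimes>\<^sub>M P)" "K \<in> P \<rightarrow>\<^sub>M subprob_algebra S"
    and f: "AE y in P. has_bochner_integral (K y) (\<lambda>x. f x y) (h y)"
    and h: "integrable P h"
  shows "path_average_defined P K f \<and> path_average P K f = (\<integral>y. h y \<partial>P)"
proof -
  have m: "(\<lambda>y. \<integral>x. f x y \<partial>K y) \<in> borel_measurable P"
    by (rule measurable_kernel_integral) fact+
  have int: "AE y in P. integrable (K y) (\<lambda>x. f x y)" and eq: "AE y in P. (\<integral>x. f x y \<partial>K y) = h y"
    using f by (auto simp: has_bochner_integral_iff)
  show ?thesis
    using int integrable_cong_AE[OF m _ eq] integral_cong_AE[OF m _ eq] h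
    by (auto simp: path_average_defined_def path_average_def)
qed

text \<open>Definedness is required of both parts: the outer integral sees only signed inner
  integrals, and divergences of the two parts could cancel in their sum.\<close>

lemma path_average_measure_split:
  assumes "case_prod f \<in> borel_measurable (S \<Otimes>\<^sub>M P)" "K \<in> P \<rightarrow>\<^sub>M subprob_algebra S"
    and split: "\<And>y. y \<in> space P \<Longrightarrow> measure_split (K y) (K1 y) (K2 y)"
    and d: "path_average_defined P K1 f" "path_average_defined P K2 f"
  shows "path_average_defined P K f \<and> path_average P K f = path_average P K1 f + path_average P K2 f"
proof -
  have "AE y in P. has_bochner_integral (K y) (\<lambda>x. f x y)
      ((\<integral>x. f x y \<partial>K1 y) + (\<integral>x. f x y \<partial>K2 y))"
    using d AE_space unfolding path_average_defined_def has_bochner_integral_iff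
    by (auto simp: integrable_measure_split_iff[OF split] integral_measure_split[OF split]
        elim: eventually_elim2)
  from path_average_eqI[OF assms(1,2) this] d show ?thesis
    by (simp add: path_average_defined_def path_average_def)
qed

lemma integrable_total_mass:
  assumes "finite_measure P" "K \<in> P \<rightarrow>\<^sub>M subprob_algebra S"
  shows "integrable P (\<lambda>y. total_mass (K y))"
proof -
  interpret finite_measure P by fact
  have "(\<lambda>y. total_mass (K y)) \<in> borel_measurable P"
    unfolding total_mass_def measure_def
    using measurable_compose[OF assms(2) emeasure_space_subprob_algebra] by measurable
  moreover have "AE y in P. norm (total_mass (K y)) \<le> 1"
    using subprob_space_kernel[OF assms(2)]
    by (auto simp: total_mass_def subprob_space.subprob_measure_le_1)
  ultimately show ?thesis by (intro integrable_const_bound)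
qed

lemma mean_mass_measure_split:
  assumes "finite_measure P" "K1 \<in> P \<rightarrow>\<^sub>M subprob_algebra S" "K2 \<in> P \<rightarrow>\<^sub>M subprob_algebra S"
    and "\<And>y. y \<in> space P \<Longrightarrow> measure_split (K y) (K1 y) (K2 y)"
  shows "mean_mass P K = mean_mass P K1 + mean_mass P K2"
proof -
  have "total_mass (K y) = total_mass (K1 y) + total_mass (K2 y)" if "y \<in> space P" for y
    using that assms subprob_space_kernel[OF assms(2)] subprob_space_kernel[OF assms(3)]
    by (intro total_mass_measure_split) (auto intro: subprob_space.axioms(1))
  then have "mean_mass P K = (\<integral>y. total_mass (K1 y) + total_mass (K2 y) \<partial>P)"
    unfolding mean_mass_def by (intro Bochner_Integration.integral_cong) auto
  then show ?thesis
    by (simp add: mean_mass_def integrable_total_mass assms(1)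
        integrable_total_mass[OF assms(1,2)] integrable_total_mass[OF assms(1,3)])
qed

text \<open>For a probability kernel this is the law of the pair (X, Y): a record is drawn from
  \<open>P\<close>, then a path from \<open>K y\<close>. Iterated averages become single integrals,
  so that Jensen's inequality is applied just once.\<close>

definition joint_law :: "'x measure \<Rightarrow> 'y measure \<Rightarrow> ('y \<Rightarrow> 'x measure) \<Rightarrow> ('x \<times> 'y) measure" where
  "joint_law S P K = P \<bind> (\<lambda>y. distr (K y) (S \<Otimes>\<^sub>M P) (\<lambda>x. (x, y)))"

lemma sets_joint_law:
  assumes "K \<in> P \<rightarrow>\<^sub>M subprob_algebra S" "space P \<noteq> {}"
  shows "sets (joint_law S P K) = sets (S \<Otimes>\<^sub>M P)"
  unfolding joint_law_def by (rule sets_bind) (use assms in auto)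

lemma nn_integral_joint_law:
  assumes K: "K \<in> P \<rightarrow>\<^sub>M subprob_algebra S" and f: "case_prod f \<in> borel_measurable (S \<Otimes>\<^sub>M P)"
  shows "(\<integral>\<^sup>+z. case_prod f z \<partial>joint_law S P K) = (\<integral>\<^sup>+y. \<integral>\<^sup>+x. f x y \<partial>K y \<partial>P)"
proof -
  have "(\<integral>\<^sup>+z. case_prod f z \<partial>joint_law S P K)
      = (\<integral>\<^sup>+y. \<integral>\<^sup>+z. case_prod f z \<partial>distr (K y) (S \<Otimes>\<^sub>M P) (\<lambda>x. (x, y)) \<partial>P)"
    unfolding joint_law_def by (rule nn_integral_bind[OF f measurable_joint_kernel[OF K]])
  also have "\<dots> = (\<integral>\<^sup>+y. \<integral>\<^sup>+x. f x y \<partial>K y \<partial>P)"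
  proof (rule nn_integral_cong)
    fix y assume "y \<in> space P"
    then show "(\<integral>\<^sup>+z. case_prod f z \<partial>distr (K y) (S \<Otimes>\<^sub>M P) (\<lambda>x. (x, y))) = (\<integral>\<^sup>+x. f x y \<partial>K y)"
      using f measurable_into_joint[OF K] by (simp add: nn_integral_distr)
  qed
  finally show ?thesis .
qed

lemma prob_space_joint_law:
  assumes P: "prob_space P" and K: "K \<in> P \<rightarrow>\<^sub>M prob_algebra S"
  shows "prob_space (joint_law S P K)"
proof
  have "K y \<in> space (prob_algebra S)" if "y \<in> space P" for y
    using measurable_space[OF K that] .
  then have "(\<integral>\<^sup>+y. \<integral>\<^sup>+x. 1 \<partial>K y \<partial>P) = (\<integral>\<^sup>+y. 1 \<partial>P)"
    by (intro nn_integral_cong) (auto simp: space_prob_algebra prob_space.emeasure_space_1)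
  then show "emeasure (joint_law S P K) (space (joint_law S P K)) = 1"
    using nn_integral_joint_law[OF measurable_prob_algebraD[OF K], of "\<lambda>_ _. 1"]
      prob_space.emeasure_space_1[OF P]
    by simp
qed

text \<open>Integrating a difference splits it anew into positive and negative parts, which are in
  general smaller than \<open>A\<close> and \<open>B\<close>. Where \<open>B\<close> is finite,
  adding \<open>B\<close> to the positive part gives the same as adding the negative part to
  \<open>A\<close>; integrating this and cancelling the finite integral of \<open>B\<close> yields
  the value.\<close>

lemma ext_integral_diff:
  fixes A B :: "'a \<Rightarrow> ennreal"
  assumes [measurable]: "A \<in> borel_measurable M" "B \<in> borel_measurable M"
    and B: "(\<integral>\<^sup>+x. B x \<partial>M) < \<infinity>"
  shows "ext_integral_defined M (\<lambda>x. enn2ereal (A x) - enn2ereal (B x))"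
    and "ext_integral M (\<lambda>x. enn2ereal (A x) - enn2ereal (B x))
      = enn2ereal (\<integral>\<^sup>+x. A x \<partial>M) - enn2ereal (\<integral>\<^sup>+x. B x \<partial>M)"
proof -
  let ?D = "\<lambda>x. enn2ereal (A x) - enn2ereal (B x)"
  have fin: "AE x in M. B x \<noteq> \<infinity>" using B by (intro nn_integral_PInf_AE) auto
  have pt: "e2ennreal (enn2ereal a - enn2ereal b) + b = a + e2ennreal (- (enn2ereal a - enn2ereal b))"
      "e2ennreal (- (enn2ereal a - enn2ereal b)) \<le> b" if "b \<noteq> \<infinity>" for a b :: ennreal
    using that by (cases a; cases b; auto simp: e2ennreal_neg ennreal_plus_if ennreal_neg ennreal_leI)+
  have neg: "(\<integral>\<^sup>+x. e2ennreal (- ?D x) \<partial>M) \<le> (\<integral>\<^sup>+x. B x \<partial>M)"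
    using fin by (intro nn_integral_mono_AE, eventually_elim) (rule pt)
  with B show "ext_integral_defined M ?D" by (auto simp: ext_integral_defined_def)
  have "(\<integral>\<^sup>+x. e2ennreal (?D x) + B x \<partial>M) = (\<integral>\<^sup>+x. A x + e2ennreal (- ?D x) \<partial>M)"
    using fin by (intro nn_integral_cong_AE, eventually_elim) (rule pt)
  then have eq: "(\<integral>\<^sup>+x. e2ennreal (?D x) \<partial>M) + (\<integral>\<^sup>+x. B x \<partial>M)
      = (\<integral>\<^sup>+x. A x \<partial>M) + (\<integral>\<^sup>+x. e2ennreal (- ?D x) \<partial>M)"
    by (simp add: nn_integral_add)
  \<comment> \<open>Cancellation is legitimate because \<open>b\<close>, and with it
    \<open>n\<close>, is finite; \<open>p\<close> and \<open>a\<close> may be infinite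
    together.\<close>
  have "enn2ereal p - enn2ereal n = enn2ereal a - enn2ereal b"
    if "p + b = a + n" "n \<le> b" "b < \<infinity>" for p n a b :: ennreal
    using that by (cases p; cases n; cases a; cases b)
      (auto simp: ennreal_plus_if top_unique simp del: ennreal_plus split: if_splits)
  from this[OF eq neg B] show "ext_integral M ?D
      = enn2ereal (\<integral>\<^sup>+x. A x \<partial>M) - enn2ereal (\<integral>\<^sup>+x. B x \<partial>M)"
    by (simp add: ext_integral_def)
qed

text \<open>A Fubini theorem for integrals that may equal \<infinity>: Tonelli's theorem applies to
  the positive and negative parts separately, and finiteness of the negative one allows recombining
  them record by record.\<close>

lemma ext_average_joint_law:
  assumes K: "K \<in> P \<rightarrow>\<^sub>M subprob_algebra S" and f: "case_prod f \<in> borel_measurable (S \<Otimes>\<^sub>M P)"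
    and neg: "(\<integral>\<^sup>+z. e2ennreal (- case_prod f z) \<partial>joint_law S P K) < \<infinity>"
  shows "ext_average_defined P K f"
    and "ext_average P K f = ext_integral (joint_law S P K) (case_prod f)"
proof -
  define A B where "A y = (\<integral>\<^sup>+x. e2ennreal (f x y) \<partial>K y)"
    and "B y = (\<integral>\<^sup>+x. e2ennreal (- f x y) \<partial>K y)" for y
  have mf: "case_prod (\<lambda>x y. e2ennreal (f x y)) \<in> borel_measurable (S \<Otimes>\<^sub>M P)"
      "case_prod (\<lambda>x y. e2ennreal (- f x y)) \<in> borel_measurable (S \<Otimes>\<^sub>M P)"
    using f by (measurable; simp add: case_prod_beta)+
  have [measurable]: "A \<in> borel_measurable P" "B \<in> borel_measurable P"
    unfolding A_def B_def using mf by (auto intro!: measurable_kernel_nn_integral[OF K])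
  have A: "(\<integral>\<^sup>+z. e2ennreal (case_prod f z) \<partial>joint_law S P K) = (\<integral>\<^sup>+y. A y \<partial>P)"
    and B: "(\<integral>\<^sup>+z. e2ennreal (- case_prod f z) \<partial>joint_law S P K) = (\<integral>\<^sup>+y. B y \<partial>P)"
    using mf[THEN nn_integral_joint_law[OF K]] by (simp_all add: A_def B_def case_prod_beta)
  have Bfin: "(\<integral>\<^sup>+y. B y \<partial>P) < \<infinity>" using neg B by simp
  then have "AE y in P. B y \<noteq> \<infinity>" by (intro nn_integral_PInf_AE) auto
  then have "AE y in P. ext_integral_defined (K y) (\<lambda>x. f x y)"
    using AE_space
  proof eventually_elim
    case (elim y)
    then show ?case
      using measurable_kernel_section[OF f K]
      by (auto simp: ext_integral_defined_def B_def less_top)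
  qed
  moreover have eq: "(\<lambda>y. ext_integral (K y) (\<lambda>x. f x y)) = (\<lambda>y. enn2ereal (A y) - enn2ereal (B y))"
    by (simp add: ext_integral_def A_def B_def)
  ultimately show "ext_average_defined P K f"
    using ext_integral_diff(1)[of A P B] Bfin by (simp add: ext_average_defined_def)
  show "ext_average P K f = ext_integral (joint_law S P K) (case_prod f)"
    unfolding ext_average_def eq using ext_integral_diff(2)[of A P B] Bfin
    by (simp add: ext_integral_def A B)
qed

subsection \<open>Processes under feedback control\<close>

context feedback_process
begin

lemma M_subprob_kernel: "M \<in> P \<rightarrow>\<^sub>M subprob_algebra S"
  by (rule measurable_prob_algebraD[OF M_kernel])

lemma Mr_subprob_kernel: "(\<lambda>y. Mr (Lam y)) \<in> P \<rightarrow>\<^sub>M subprob_algebra S"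
  by (rule measurable_prob_algebraD[OF Mr_kernel])

lemma Mr_split: "y \<in> space P \<Longrightarrow> measure_split (Mr (Lam y)) (MrAC y) (MrS y)"
  using decomposition by (simp add: lebesgue_decomposition_def)

definition weight :: "'x \<Rightarrow> 'y \<Rightarrow> ennreal" where
  "weight x y = eexp (- \<sigma> x y - I x y - Ii x y)"

lemma measurable_weight: "case_prod weight \<in> borel_measurable (S \<Otimes>\<^sub>M P)"
proof -
  note [measurable] = \<sigma>_measurable I_measurable Ii_measurable
  show ?thesis unfolding weight_def by measurable
qed

text \<open>By the chain rule \<open>weight\<close> is a density of \<open>MrAC y\<close>. Outside the support of the density of
  \<open>Mtr\<close> nothing is known about \<open>\<sigma>\<close>, but there \<open>I + Ii = \<infinity>\<close> makes the weight vanish.\<close>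

lemma density_weight:
  assumes y: "y \<in> space P"
  shows "density (M y) (\<lambda>x. weight x y) = MrAC y"
proof -
  define h where "h = RN_deriv (M y) (Mtr (Lam y))"
  define g where "g = RN_deriv (Mtr (Lam y)) (MrAC y)"
  have sets: "sets (M y) = sets S" "sets (Mtr (Lam y)) = sets S" "sets (MrAC y) = sets S"
    using y subprob_measurableD(2)[OF M_subprob_kernel]
      subprob_measurableD(2)[OF measurable_prob_algebraD[OF Mtr_kernel]]
      subprob_measurableD(2)[OF MrAC_kernel] by auto
  have sp: "space (M y) = space S" using sets by (auto dest: sets_eq_imp_space_eq)
  have "prob_space (M y)" "prob_space (Mtr (Lam y))"
    using y measurable_space[OF M_kernel] measurable_space[OF Mtr_kernel]
    by (auto simp: space_prob_algebra)
  then have sf: "sigma_finite_measure (M y)" "sigma_finite_measure (Mtr (Lam y))"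
    by (auto intro: finite_measure.sigma_finite_measure prob_space.finite_measure)
  have t: "density (M y) h = Mtr (Lam y)"
    unfolding h_def using sf ac_Mtr[OF y] sets
    by (intro sigma_finite_measure.density_RN_deriv) auto
  have a: "density (Mtr (Lam y)) g = MrAC y"
    unfolding g_def using sf ac_MrAC[OF y] sets
    by (intro sigma_finite_measure.density_RN_deriv) auto
  have [measurable]: "h \<in> borel_measurable (M y)" "g \<in> borel_measurable (M y)"
    using borel_measurable_RN_deriv[of "Mtr (Lam y)" "MrAC y"] sets
    by (auto simp: h_def g_def cong: measurable_cong_sets)
  \<comment> \<open>Writing \<open>Mtr\<close> as a density over \<open>M y\<close> turns this
    almost-everywhere statement into one about the points where \<open>h\<close> is
    positive.\<close>
  have "AE x in density (M y) h. eexp (- \<sigma> x y) = g x"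
    unfolding t g_def by (rule entropy_production[OF y])
  then have "AE x in M y. 0 < h x \<longrightarrow> eexp (- \<sigma> x y) = g x"
    by (simp add: AE_density)
  then have "AE x in M y. h x * g x = weight x y"
    using information[OF y] AE_space
  proof eventually_elim
    case (elim x)
    then have *: "eexp (- I x y - Ii x y) = h x" by (simp add: h_def)
    have "weight x y = eexp (- \<sigma> x y) * h x"
      unfolding weight_def *[symmetric] using not_MInfty[of x y] y elim sp
      by (intro eexp_minus_diff) auto
    then show ?case using elim by (cases "h x = 0") (auto simp: mult.commute zero_less_iff_neq_zero)
  qed
  then have "density (M y) (\<lambda>x. h x * g x) = density (M y) (\<lambda>x. weight x y)"
    using measurable_kernel_section[OF measurable_weight M_subprob_kernel y]
    by (intro density_cong) auto
  then show ?thesis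
    by (simp add: a t flip: density_density_eq)
qed

text \<open>Integrating against the weight is integrating over \<open>MrAC y\<close>, which is what
  remains of the reference measure without \<open>MrS y\<close>. Integrability over both parts is
  inherited from the whole.\<close>

lemma has_bochner_integral_weight:
  fixes f :: "'x \<Rightarrow> real"
  assumes y: "y \<in> space P" and f: "integrable (Mr (Lam y)) f"
  shows "has_bochner_integral (M y) (\<lambda>x. f x * enn2real (weight x y))
    ((\<integral>x. f x \<partial>Mr (Lam y)) - (\<integral>x. f x \<partial>MrS y))"
proof -
  let ?w = "\<lambda>x. enn2real (weight x y)"
  have sets: "sets (M y) = sets S" "sets (MrAC y) = sets S"
    using y subprob_measurableD(2)[OF M_subprob_kernel] subprob_measurableD(2)[OF MrAC_kernel] by auto
  then have sp: "space (M y) = space S" by (auto dest: sets_eq_imp_space_eq)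
  have [measurable]: "?w \<in> borel_measurable (M y)"
    using measurable_kernel_section[OF measurable_weight M_subprob_kernel y] by measurable
  have int: "integrable (MrAC y) f" "integrable (MrS y) f"
    using f by (simp_all add: integrable_measure_split_iff[OF Mr_split[OF y]])
  then have [measurable]: "f \<in> borel_measurable (M y)"
    using sets by (auto dest!: borel_measurable_integrable cong: measurable_cong_sets)
  \<comment> \<open>Finiteness is essential for passing to real values, as \<open>enn2real\<close>
    sends \<infinity> to 0.\<close>
  have "weight x y < \<infinity>" if "x \<in> space S" for x
    using not_MInfty[OF that y] unfolding weight_def
    by (intro eexp_finite; cases "\<sigma> x y"; cases "I x y"; cases "Ii x y") auto
  then have "density (M y) (\<lambda>x. ennreal (?w x)) = MrAC y"
    using sp unfolding density_weight[OF y, symmetric]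
    by (intro density_cong)
      (use measurable_kernel_section[OF measurable_weight M_subprob_kernel y] in auto)
  then have "has_bochner_integral (M y) (\<lambda>x. f x * ?w x) (\<integral>x. f x \<partial>MrAC y)"
    using int(1) integrable_density[of f "M y" ?w] integral_density[of f "M y" ?w]
    by (simp add: has_bochner_integral_iff mult.commute)
  then show ?thesis
    using integral_measure_split[OF Mr_split[OF y] int] by simp
qed

lemma has_bochner_integral_weight_1:
  assumes y: "y \<in> space P"
  shows "has_bochner_integral (M y) (\<lambda>x. enn2real (weight x y)) (1 - total_mass (MrS y))"
proof -
  interpret Mr: prob_space "Mr (Lam y)"
    using measurable_space[OF Mr_kernel y] by (simp add: space_prob_algebra)
  show ?thesis
    using has_bochner_integral_weight[OF y, of "\<lambda>_. 1"] by (simp add: total_mass_def Mr.prob_space)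
qed

text \<open>Admitting any version \<open>w\<close> of the weight covers the case without initial
  correlation, where \<open>Ii\<close> vanishes only almost everywhere and is dropped from the
  exponent.\<close>

lemma AE_has_bochner_integral_weight:
  assumes w: "case_prod w \<in> borel_measurable (S \<Otimes>\<^sub>M P)"
    and eq: "AE y in P. AE x in M y. w x y = weight x y"
    and F: "case_prod F \<in> borel_measurable (S \<Otimes>\<^sub>M P)"
    and int: "AE y in P. has_bochner_integral (M y) (\<lambda>x. F x y * enn2real (weight x y)) (h y)"
  shows "AE y in P. has_bochner_integral (M y) (\<lambda>x. F x y * enn2real (w x y)) (h y)"
  using eq int AE_space
proof eventually_elim
  case (elim y)
  have [measurable]: "(\<lambda>x. F x y) \<in> borel_measurable (M y)" "(\<lambda>x. w x y) \<in> borel_measurable (M y)"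
    "(\<lambda>x. weight x y) \<in> borel_measurable (M y)"
    using measurable_kernel_section[OF F M_subprob_kernel] measurable_kernel_section[OF w M_subprob_kernel]
      measurable_kernel_section[OF measurable_weight M_subprob_kernel] elim by auto
  have "AE x in M y. F x y * enn2real (w x y) = F x y * enn2real (weight x y)"
    using elim(1) by eventually_elim simp
  then show ?case
    using elim(2) has_bochner_integral_cong_AE[of "\<lambda>x. F x y * enn2real (w x y)" "M y"
        "\<lambda>x. F x y * enn2real (weight x y)"] by simp
qed

text \<open>Definedness over \<open>MrS\<close> is a separate assumption: inner integrability is
  inherited from the reference measure, but integrability over the records is not.\<close>

lemma path_average_weight:
  assumes w: "case_prod w \<in> borel_measurable (S \<Otimes>\<^sub>M P)"
    and eq: "AE y in P. AE x in M y. w x y = weight x y"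
    and F: "case_prod F \<in> borel_measurable (S \<Otimes>\<^sub>M P)"
    and d: "path_average_defined P (\<lambda>y. Mr (Lam y)) F" "path_average_defined P MrS F"
  shows "path_average_defined P M (\<lambda>x y. F x y * enn2real (w x y)) \<and>
    path_average P M (\<lambda>x y. F x y * enn2real (w x y))
      = path_average P (\<lambda>y. Mr (Lam y)) F - path_average P MrS F"
proof -
  note [measurable] = w F
  have "AE y in P. has_bochner_integral (M y) (\<lambda>x. F x y * enn2real (weight x y))
      ((\<integral>x. F x y \<partial>Mr (Lam y)) - (\<integral>x. F x y \<partial>MrS y))"
    using d(1) AE_space unfolding path_average_defined_def
    by (auto intro: has_bochner_integral_weight elim: eventually_elim2)
  from path_average_eqI[OF _ M_subprob_kernel AE_has_bochner_integral_weight[OF w eq F this]] d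
  show ?thesis
    by (simp add: path_average_defined_def path_average_def)
qed

lemma integrable_mass_defect: "integrable P (\<lambda>y. 1 - total_mass (MrS y))"
  using integrable_total_mass[OF finite_measure_axioms MrS_kernel] by simp

lemma integral_mass_defect: "(\<integral>y. 1 - total_mass (MrS y) \<partial>P) = 1 - mean_mass P MrS"
  using integrable_total_mass[OF finite_measure_axioms MrS_kernel]
  by (simp add: mean_mass_def prob_space)

lemma path_average_weight_1:
  assumes w: "case_prod w \<in> borel_measurable (S \<Otimes>\<^sub>M P)"
    and eq: "AE y in P. AE x in M y. w x y = weight x y"
  shows "path_average_defined P M (\<lambda>x y. enn2real (w x y)) \<and>
    path_average P M (\<lambda>x y. enn2real (w x y)) = 1 - mean_mass P MrS"
proof -
  note [measurable] = w
  have "AE y in P. has_bochner_integral (M y) (\<lambda>x. 1 * enn2real (w x y)) (1 - total_mass (MrS y))"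
    using has_bochner_integral_weight_1
    by (intro AE_has_bochner_integral_weight[OF w eq]) auto
  then have "AE y in P. has_bochner_integral (M y) (\<lambda>x. enn2real (w x y)) (1 - total_mass (MrS y))"
    by simp
  from path_average_eqI[OF _ M_subprob_kernel this integrable_mass_defect] show ?thesis
    by (simp add: integral_mass_defect)
qed

text \<open>Jensen's inequality on the joint law, where the exponential has mean
  \<open>1 - mean_mass P MrS\<close>. A general \<open>J\<close> serves both for the total
  \<open>I + Ii\<close> and, without initial correlation, for \<open>I\<close> alone.\<close>

lemma entropy_production_bound:
  assumes J: "case_prod J \<in> borel_measurable (S \<Otimes>\<^sub>M P)"
    and eq: "AE y in P. AE x in M y. J x y = I x y + Ii x y"
    and int: "path_integrable P M J"
  shows "ext_average_defined P M \<sigma> \<and>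
    ext_average P M \<sigma> \<ge> - ext_average P M J - eln (1 - mean_mass P MrS)"
proof -
  let ?Q = "joint_law S P M"
  note [measurable] = J \<sigma>_measurable
  note joint = nn_integral_joint_law[OF M_subprob_kernel]
  interpret Q: prob_space ?Q
    by (rule prob_space_joint_law[OF prob_space_axioms M_kernel])
  have setsQ [measurable_cong]: "sets ?Q = sets (S \<Otimes>\<^sub>M P)"
    by (rule sets_joint_law[OF M_subprob_kernel not_empty])
  have "(\<integral>\<^sup>+x. eexp (- \<sigma> x y - J x y) \<partial>M y) = ennreal (1 - total_mass (MrS y))"
    if y: "y \<in> space P" and "AE x in M y. J x y = I x y + Ii x y" for y
  proof -
    have sp: "space (M y) = space S" using subprob_measurableD(1)[OF M_subprob_kernel y] .
    have "AE x in M y. eexp (- \<sigma> x y - J x y) = ennreal (enn2real (weight x y))"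
      using that(2) AE_space
    proof eventually_elim
      case (elim x)
      \<comment> \<open>Regrouping the exponent is safe in \<open>ereal\<close> because no term is
        \<open>- \<infinity>\<close>; the same fact makes the weight finite.\<close>
      then show ?case using not_MInfty[of x y] y sp
        unfolding weight_def by (cases "\<sigma> x y"; cases "I x y"; cases "Ii x y") (auto simp: algebra_simps)
    qed
    then have "(\<integral>\<^sup>+x. eexp (- \<sigma> x y - J x y) \<partial>M y) = (\<integral>\<^sup>+x. ennreal (enn2real (weight x y)) \<partial>M y)"
      by (rule nn_integral_cong_AE)
    also have "\<dots> = ennreal (1 - total_mass (MrS y))"
      using has_bochner_integral_weight_1[OF y]
      by (auto simp: has_bochner_integral_iff nn_integral_eq_integral)
    finally show ?thesis .
  qed
  then have "(\<integral>\<^sup>+z. eexp (- case_prod \<sigma> z - case_prod J z) \<partial>?Q)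
      = (\<integral>\<^sup>+y. ennreal (1 - total_mass (MrS y)) \<partial>P)"
    using joint[of "\<lambda>x y. eexp (- \<sigma> x y - J x y)"] eq AE_space
    by (auto simp: case_prod_beta intro!: nn_integral_cong_AE elim: eventually_elim2)
  moreover have mass: "0 \<le> 1 - total_mass (MrS y)" if "y \<in> space P" for y
    using subprob_space.subprob_measure_le_1[OF subprob_space_kernel[OF MrS_kernel that]]
    by (simp add: total_mass_def)
  ultimately have E: "(\<integral>\<^sup>+z. eexp (- case_prod \<sigma> z - case_prod J z) \<partial>?Q) = ennreal (1 - mean_mass P MrS)"
    using nn_integral_eq_integral[OF integrable_mass_defect] by (simp add: integral_mass_defect)
  have E01: "0 \<le> 1 - mean_mass P MrS" "1 - mean_mass P MrS \<le> 1"
    using mass unfolding integral_mass_defect[symmetric]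
    by (auto intro!: integral_nonneg integral_le_const integrable_mass_defect total_mass_nonneg)
  have s: "AE z in ?Q. case_prod \<sigma> z \<noteq> - \<infinity>"
    using not_MInfty by (intro AE_I2) (auto simp: sets_eq_imp_space_eq[OF setsQ] space_pair_measure)
  have j: "(\<integral>\<^sup>+z. e2ennreal \<bar>case_prod J z\<bar> \<partial>?Q) < \<infinity>"
    using int joint[of "\<lambda>x y. e2ennreal \<bar>J x y\<bar>"] by (simp add: path_integrable_def case_prod_beta)
  have "(\<integral>\<^sup>+z. e2ennreal (- case_prod J z) \<partial>?Q) \<le> (\<integral>\<^sup>+z. e2ennreal \<bar>case_prod J z\<bar> \<partial>?Q)"
    by (intro nn_integral_mono e2ennreal_mono) (simp add: ereal_minus_le_abs)
  then have negJ: "(\<integral>\<^sup>+z. e2ennreal (- case_prod J z) \<partial>?Q) < \<infinity>"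
    using j by (rule le_less_trans)
  \<comment> \<open>Only the negative part has to be finite; the average of \<sigma> itself may be
    \<infinity>.\<close>
  have neg\<sigma>: "(\<integral>\<^sup>+z. e2ennreal (- case_prod \<sigma> z) \<partial>?Q) < \<infinity>"
    by (rule Q.nn_integral_neg_finite[OF _ _ s j]) (simp_all add: E)
  have "ext_integral ?Q (case_prod \<sigma>) \<ge> - ext_integral ?Q (case_prod J) - eln (1 - mean_mass P MrS)"
    by (rule Q.ext_integral_ge_eln[OF _ _ s j E E01]) simp_all
  then show ?thesis
    using ext_average_joint_law[OF M_subprob_kernel J negJ]
      ext_average_joint_law[OF M_subprob_kernel \<sigma>_measurable neg\<sigma>] by simp
qed

end

theorem mainTheorem5:
  fixes P :: "'y measure" and S :: "'x measure" and Lam :: "'y \<Rightarrow> 'l"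
    and M MrAC MrS Mrsc Mrd :: "'y \<Rightarrow> 'x measure"
    and Mtr Mr :: "'l \<Rightarrow> 'x measure"
    and \<sigma> I Ii :: "'x \<Rightarrow> 'y \<Rightarrow> ereal"
    and F :: "'x \<Rightarrow> 'y \<Rightarrow> real"
  assumes "feedback_process P S Lam M Mtr Mr MrAC MrS \<sigma> I Ii"
    and "(\<lambda>(x, y). F x y) \<in> borel_measurable (S \<Otimes>\<^sub>M P)"
  shows
    "((AE y in P. integrable (Mr (Lam y)) (\<lambda>x. F x y)) \<longrightarrow>
      (AE y in P. has_bochner_integral (M y)
         (\<lambda>x. F x y * enn2real (eexp (- \<sigma> x y - I x y - Ii x y)))
         ((\<integral>x. F x y \<partial>Mr (Lam y)) - (\<integral>x. F x y \<partial>MrS y))))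
     \<and> (AE y in P. has_bochner_integral (M y)
         (\<lambda>x. enn2real (eexp (- \<sigma> x y - I x y - Ii x y)))
         (1 - total_mass (MrS y)))
     \<and> (path_average_defined P (\<lambda>y. Mr (Lam y)) F \<and> path_average_defined P MrS F \<longrightarrow>
        path_average_defined P M (\<lambda>x y. F x y * enn2real (eexp (- \<sigma> x y - I x y - Ii x y))) \<and>
        path_average P M (\<lambda>x y. F x y * enn2real (eexp (- \<sigma> x y - I x y - Ii x y)))
          = path_average P (\<lambda>y. Mr (Lam y)) F - path_average P MrS F)
     \<and> path_average_defined P M (\<lambda>x y. enn2real (eexp (- \<sigma> x y - I x y - Ii x y)))
     \<and> path_average P M (\<lambda>x y. enn2real (eexp (- \<sigma> x y - I x y - Ii x y))) = 1 - mean_mass P MrS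
     \<and> (path_integrable P M (\<lambda>x y. I x y + Ii x y) \<longrightarrow>
        ext_average_defined P M \<sigma> \<and>
        ext_average P M \<sigma>
          \<ge> - ext_average P M (\<lambda>x y. I x y + Ii x y) - eln (1 - mean_mass P MrS))
     \<and> ((AE y in P. AE x in M y. Ii x y = 0) \<longrightarrow>
       (path_average_defined P (\<lambda>y. Mr (Lam y)) F \<and> path_average_defined P MrS F \<longrightarrow>
          path_average_defined P M (\<lambda>x y. F x y * enn2real (eexp (- \<sigma> x y - I x y))) \<and>
          path_average P M (\<lambda>x y. F x y * enn2real (eexp (- \<sigma> x y - I x y)))
            = path_average P (\<lambda>y. Mr (Lam y)) F - path_average P MrS F)
       \<and> path_average_defined P M (\<lambda>x y. enn2real (eexp (- \<sigma> x y - I x y)))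
       \<and> path_average P M (\<lambda>x y. enn2real (eexp (- \<sigma> x y - I x y))) = 1 - mean_mass P MrS
       \<and> (path_integrable P M I \<longrightarrow>
          ext_average_defined P M \<sigma> \<and>
          ext_average P M \<sigma> \<ge> - ext_average P M I - eln (1 - mean_mass P MrS)))
     \<and> ((AE y in P. AE x in M y. Ii x y = 0)
     \<and> (\<forall>y\<in>space P. continuous_measure (M y))
     \<and> Mrsc \<in> P \<rightarrow>\<^sub>M subprob_algebra S
     \<and> Mrd \<in> P \<rightarrow>\<^sub>M subprob_algebra S
     \<and> (\<forall>y\<in>space P. continuous_discrete_decomposition (MrS y) (Mrsc y) (Mrd y)) \<longrightarrow>
       (path_average_defined P (\<lambda>y. Mr (Lam y)) F \<and> path_average_defined P Mrsc F
          \<and> path_average_defined P Mrd F \<longrightarrow>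
          path_average_defined P M (\<lambda>x y. F x y * enn2real (eexp (- \<sigma> x y - I x y))) \<and>
          path_average P M (\<lambda>x y. F x y * enn2real (eexp (- \<sigma> x y - I x y)))
            = path_average P (\<lambda>y. Mr (Lam y)) F - path_average P Mrsc F - path_average P Mrd F)
       \<and> path_average_defined P M (\<lambda>x y. enn2real (eexp (- \<sigma> x y - I x y)))
       \<and> path_average P M (\<lambda>x y. enn2real (eexp (- \<sigma> x y - I x y)))
           = 1 - mean_mass P Mrsc - mean_mass P Mrd
       \<and> (path_integrable P M I \<longrightarrow>
          ext_average_defined P M \<sigma> \<and>
          ext_average P M \<sigma>
            \<ge> - ext_average P M I - eln (1 - mean_mass P Mrsc - mean_mass P Mrd)))"
proof -
  interpret feedback_process P S Lam M Mtr Mr MrAC MrS \<sigma> I Ii by fact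
  note F = assms(2)
  note [measurable] = \<sigma>_measurable I_measurable Ii_measurable
  \<comment> \<open>\<open>v\<close> is the weight with the initial correlation left out;
    \<open>Ii0\<close> below identifies it with \<open>weight\<close> almost everywhere when
    \<open>Ii\<close> vanishes almost everywhere.\<close>
  define v where "v x y = eexp (- \<sigma> x y - I x y)" for x y
  define J where "J x y = I x y + Ii x y" for x y
  have v: "case_prod v \<in> borel_measurable (S \<Otimes>\<^sub>M P)" unfolding v_def by measurable
  have J: "case_prod J \<in> borel_measurable (S \<Otimes>\<^sub>M P)" unfolding J_def by measurable
  note vdef = v_def[symmetric] and wdef = weight_def[symmetric] and Jdef = J_def[symmetric]
  have Ii0: "(AE y in P. AE x in M y. v x y = weight x y) \<and>
      (AE y in P. AE x in M y. I x y = J x y)"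
    if "AE y in P. AE x in M y. Ii x y = 0"
    using that by (auto simp: v_def weight_def J_def elim!: eventually_mono)
  \<comment> \<open>Adding up the singular continuous and discrete parts reduces the final group of
    claims to the preceding one, stated with \<open>MrS\<close>.\<close>
  have mean: "mean_mass P Mrsc + mean_mass P Mrd = mean_mass P MrS"
    and avg: "path_average_defined P Mrsc F \<Longrightarrow> path_average_defined P Mrd F \<Longrightarrow>
      path_average_defined P MrS F \<and>
      path_average P MrS F = path_average P Mrsc F + path_average P Mrd F"
    if "Mrsc \<in> P \<rightarrow>\<^sub>M subprob_algebra S" "Mrd \<in> P \<rightarrow>\<^sub>M subprob_algebra S"
      "\<forall>y\<in>space P. continuous_discrete_decomposition (MrS y) (Mrsc y) (Mrd y)"
  proof -
    have sp: "measure_split (MrS y) (Mrsc y) (Mrd y)" if "y \<in> space P" for y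
      using that \<open>\<forall>y\<in>space P. _ y\<close> by (simp add: continuous_discrete_decomposition_def)
    show "mean_mass P Mrsc + mean_mass P Mrd = mean_mass P MrS"
      using that sp by (intro mean_mass_measure_split[symmetric] finite_measure_axioms) auto
    show "path_average_defined P Mrsc F \<Longrightarrow> path_average_defined P Mrd F \<Longrightarrow>
      path_average_defined P MrS F \<and>
      path_average P MrS F = path_average P Mrsc F + path_average P Mrd F"
      by (rule path_average_measure_split[OF F MrS_kernel sp])
  qed
  have "(AE y in P. has_bochner_integral (M y) (\<lambda>x. F x y * enn2real (weight x y))
         ((\<integral>x. F x y \<partial>Mr (Lam y)) - (\<integral>x. F x y \<partial>MrS y)))"
    if "AE y in P. integrable (Mr (Lam y)) (\<lambda>x. F x y)"
    using that AE_space by eventually_elim (rule has_bochner_integral_weight)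
  moreover have "AE y in P. has_bochner_integral (M y) (\<lambda>x. enn2real (weight x y)) (1 - total_mass (MrS y))"
    using AE_space by eventually_elim (rule has_bochner_integral_weight_1)
  moreover note path_average_weight[OF measurable_weight _ F] path_average_weight_1[OF measurable_weight]
    path_average_weight[OF v _ F] path_average_weight_1[OF v]
    entropy_production_bound[OF J] entropy_production_bound[OF I_measurable]
  ultimately show ?thesis
    unfolding vdef wdef Jdef
    using Ii0 mean avg by (simp add: diff_diff_eq)
qed

end
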